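(* Let $(X,d)$ be a complete semimetric space with a continuous triangle function $\Phi$ satisfying the following conditions: 1) $\Phi(ku,kv)=k\Phi(u,v)$ for all $k,u,v\in[0,\infty)$; 2) for every $0\leqslant a<1$ there exists $C(a)>0$ such that for every positive integer $p$ one has $\Phi(1,\Phi(a,\Phi(a^2,\ldots,\Phi(a^{p-1},a^{p}))))\leqslant C(a)$. Let $T\colon X\to X$ satisfy, for some $0\leqslant\beta<\frac12$, the inequality $$d(Tx,Ty)\leqslant\beta\,(d(x,Tx)+d(y,Ty))\quad\text{for all }x,y\in X,$$ and suppose additionally that $\Phi(0,\beta)<1$. Then $T$ has a unique fixed point.
   Context: Let $X$ be a nonempty set. A semimetric on $X$ is a map $d\colon X\times X\to[0,\infty)$ such that $d(x,y)=0$ if and only if $x=y$, and $d(x,y)=d(y,x)$ for all $x,y\in X$ (no triangle inequality is required). The pair $(X,d)$ is then called a semimetric space. A function $\Phi\colon[0,\infty)\times[0,\infty)\to[0,\infty)$ is a triangle function for $d$ if $\Phi$ is symmetric, nondecreasing in each of its arguments, $\Phi(0,0)=0$, and $d(x,y)\leqslant\Phi(d(x,z),d(z,y))$ for all $x,y,z\in X$. Convergence, Cauchy sequences and completeness are defined as usual: $x_n\to x$ means $d(x_n,x)\to0$; $(x_n)$ is Cauchy if for every $\varepsilon>0$ there is $N$ with $d(x_n,x_m)<\varepsilon$ for all $n,m\geqslant N$; $(X,d)$ is complete if every Cauchy sequence converges to a point of $X$. For $p=1$ the nested expression in condition 2) is $\Phi(1,a)$, for $p=2$ it is $\Phi(1,\Phi(a,a^2))$,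 and so on (with $a^0=1$). *)

theory Defs
  imports Complex_Main "HOL-Library.FuncSet"
begin

locale semimetric_space =
  fixes X :: "'a set" and d :: "'a \<Rightarrow> 'a \<Rightarrow> real"
  assumes nonempty: "X \<noteq> {}"
    and nonneg: "\<And>x y. x \<in> X \<Longrightarrow> y \<in> X \<Longrightarrow> 0 \<le> d x y"
    and zero_iff: "\<And>x y. x \<in> X \<Longrightarrow> y \<in> X \<Longrightarrow> d x y = 0 \<longleftrightarrow> x = y"
    and sym: "\<And>x y. x \<in> X \<Longrightarrow> y \<in> X \<Longrightarrow> d x y = d y x"

definition sm_converges :: "('a \<Rightarrow> 'a \<Rightarrow> real) \<Rightarrow> (nat \<Rightarrow> 'a) \<Rightarrow> 'a \<Rightarrow> bool" where
  "sm_converges d s l \<longleftrightarrow> (\<lambda>n. d (s n) l) \<longlonglongrightarrow> 0"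

definition sm_Cauchy :: "('a \<Rightarrow> 'a \<Rightarrow> real) \<Rightarrow> (nat \<Rightarrow> 'a) \<Rightarrow> bool" where
  "sm_Cauchy d s \<longleftrightarrow> (\<forall>\<epsilon>>0. \<exists>N. \<forall>n\<ge>N. \<forall>m\<ge>N. d (s n) (s m) < \<epsilon>)"

definition sm_complete :: "'a set \<Rightarrow> ('a \<Rightarrow> 'a \<Rightarrow> real) \<Rightarrow> bool" where
  "sm_complete X d \<longleftrightarrow>
     (\<forall>s. (\<forall>n. s n \<in> X) \<and> sm_Cauchy d s \<longrightarrow> (\<exists>l\<in>X. sm_converges d s l))"

text \<open>A function on \<open>[0,\<infinity>) \<times> [0,\<infinity>)\<close> is represented by a total function on the
  reals of which only the values at nonnegative arguments matter.\<close>

definition triangle_function ::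
    "'a set \<Rightarrow> ('a \<Rightarrow> 'a \<Rightarrow> real) \<Rightarrow> (real \<Rightarrow> real \<Rightarrow> real) \<Rightarrow> bool" where
  "triangle_function X d \<Phi> \<longleftrightarrow>
     (\<forall>u\<ge>0. \<forall>v\<ge>0. 0 \<le> \<Phi> u v) \<and>
     (\<forall>u\<ge>0. \<forall>v\<ge>0. \<Phi> u v = \<Phi> v u) \<and>
     (\<forall>v\<ge>0. mono_on {0..} (\<lambda>u. \<Phi> u v)) \<and>
     (\<forall>u\<ge>0. mono_on {0..} (\<lambda>v. \<Phi> u v)) \<and>
     \<Phi> 0 0 = 0 \<and>
     (\<forall>x\<in>X. \<forall>y\<in>X. \<forall>z\<in>X. d x y \<le> \<Phi> (d x z) (d z y))"

text \<open>\<open>nested \<Phi> a i p\<close> is \<open>\<Phi>(a\<^sup>i, \<Phi>(a\<^sup>i\<^sup>+\<^sup>1, \<dots> \<Phi>(a\<^sup>i\<^sup>+\<^sup>p\<^sup>-\<^sup>1, a\<^sup>i\<^sup>+\<^sup>p)))\<close>, with \<open>p\<close>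
  occurrences of \<open>\<Phi>\<close>.\<close>

primrec nested :: "(real \<Rightarrow> real \<Rightarrow> real) \<Rightarrow> real \<Rightarrow> nat \<Rightarrow> nat \<Rightarrow> real" where
  "nested \<Phi> a i 0 = a ^ i"
| "nested \<Phi> a i (Suc p) = \<Phi> (a ^ i) (nested \<Phi> a (Suc i) p)"

end

theory Submission imports Defs begin

text \<open>The steps \<open>d (T\<^sup>n x) (T\<^sup>n\<^sup>+\<^sup>1 x)\<close> of a Picard orbit decay geometrically with ratio
  \<open>\<beta> / (1 - \<beta>) < 1\<close>.  The contraction inequality bounds the distance between any two orbit points
  by the steps preceding them, so the orbit is Cauchy without any chaining of triangle inequalities.
  For its limit \<open>l\<close>, with \<open>r = d l (T l)\<close>, letting \<open>n\<close> grow in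
  \<open>r \<le> \<Phi> (d l x\<^sub>n\<^sub>+\<^sub>1) (\<beta> * (d x\<^sub>n x\<^sub>n\<^sub>+\<^sub>1 + r))\<close> gives \<open>r \<le> \<Phi> 0 (\<beta> * r) = r * \<Phi> 0 \<beta>\<close>, whence \<open>r = 0\<close>.\<close>

locale kannan_map = semimetric_space +
  fixes T :: "'a \<Rightarrow> 'a" and \<beta> :: real
  assumes T_closed: "T \<in> X \<rightarrow> X"
    and beta_nonneg: "0 \<le> \<beta>" and beta_half: "\<beta> < 1 / 2"
    and kannan: "\<And>x y. x \<in> X \<Longrightarrow> y \<in> X \<Longrightarrow> d (T x) (T y) \<le> \<beta> * (d x (T x) + d y (T y))"
begin

lemma orbit_closed: "x \<in> X \<Longrightarrow> (T ^^ n) x \<in> X"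
  by (induction n) (use T_closed in auto)

text \<open>At fixed points both steps on the right of the contraction inequality vanish.\<close>

lemma fixed_point_unique:
  assumes "x \<in> X" "T x = x" "y \<in> X" "T y = y"
  shows "x = y"
proof -
  have "d x y \<le> 0"
    using kannan[of x y] zero_iff[of x x] zero_iff[of y y] assms by simp
  then show ?thesis
    using nonneg[of x y] zero_iff[of x y] assms by simp
qed

text \<open>Applied to \<open>x\<close> and \<open>T x\<close>, the contraction inequality has
  \<open>d (T x) (T (T x))\<close> on both sides; solving for it divides by
  \<open>1 - \<beta>\<close>, which is positive.\<close>

lemma step_contraction:
  assumes "x \<in> X"
  shows "d (T x) (T (T x)) \<le> \<beta> / (1 - \<beta>) * d x (T x)"
proof -
  have "d (T x) (T (T x)) \<le> \<beta> * (d x (T x) + d (T x) (T (T x)))"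
    using kannan[of x "T x"] T_closed assms by blast
  then show ?thesis
    using beta_half by (simp add: field_simps)
qed

lemma orbit_step_le:
  assumes "x \<in> X"
  shows "d ((T ^^ n) x) (T ((T ^^ n) x)) \<le> (\<beta> / (1 - \<beta>)) ^ n * d x (T x)"
proof (induction n)
  case (Suc n)
  have "d ((T ^^ Suc n) x) (T ((T ^^ Suc n) x)) \<le> \<beta> / (1 - \<beta>) * d ((T ^^ n) x) (T ((T ^^ n) x))"
    using step_contraction[OF orbit_closed[OF assms]] by simp
  also have "\<dots> \<le> \<beta> / (1 - \<beta>) * ((\<beta> / (1 - \<beta>)) ^ n * d x (T x))"
    using beta_nonneg beta_half by (intro mult_left_mono Suc) auto
  finally show ?case
    by (simp add: mult.assoc)
qed simp

lemma orbit_step_tendsto_0: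
  assumes "x \<in> X"
  shows "(\<lambda>n. d ((T ^^ n) x) (T ((T ^^ n) x))) \<longlonglongrightarrow> 0"
proof (rule tendsto_sandwich[OF _ _ tendsto_const])
  have "T ((T ^^ n) x) \<in> X" for n
    using orbit_closed[OF assms, of "Suc n"] by simp
  then show "\<forall>\<^sub>F n in sequentially. 0 \<le> d ((T ^^ n) x) (T ((T ^^ n) x))"
    using nonneg orbit_closed[OF assms] by simp
  show "\<forall>\<^sub>F n in sequentially.
      d ((T ^^ n) x) (T ((T ^^ n) x)) \<le> (\<beta> / (1 - \<beta>)) ^ n * d x (T x)"
    using orbit_step_le[OF assms] by simp
  \<comment> \<open>The ratio is below 1 because \<open>2 * \<beta> < 1\<close>.\<close>
  have "(\<lambda>n. (\<beta> / (1 - \<beta>)) ^ n) \<longlonglongrightarrow> 0"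
    using beta_nonneg beta_half by (intro LIMSEQ_power_zero) (simp add: field_simps)
  then show "(\<lambda>n. (\<beta> / (1 - \<beta>)) ^ n * d x (T x)) \<longlonglongrightarrow> 0"
    by (rule tendsto_mult_left_zero)
qed

lemma orbit_Cauchy:
  assumes "x \<in> X"
  shows "sm_Cauchy d (\<lambda>n. (T ^^ n) x)"
  unfolding sm_Cauchy_def
proof (intro allI impI)
  fix \<epsilon> :: real
  assume "\<epsilon> > 0"
  then have "\<forall>\<^sub>F n in sequentially. d ((T ^^ n) x) (T ((T ^^ n) x)) < \<epsilon>"
    using order_tendstoD(2)[OF orbit_step_tendsto_0[OF assms]] by blast
  then obtain N where N: "\<And>n. n \<ge> N \<Longrightarrow> d ((T ^^ n) x) (T ((T ^^ n) x)) < \<epsilon>"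
    by (auto simp: eventually_sequentially)
  \<comment> \<open>Indices start at \<open>Suc N\<close> because the contraction inequality bounds
    distances between images under \<open>T\<close>: each point needs a predecessor whose step is
    already below \<open>\<epsilon>\<close>.\<close>
  have "d ((T ^^ n) x) ((T ^^ m) x) < \<epsilon>" if nm: "n \<ge> Suc N" "m \<ge> Suc N" for n m
  proof -
    obtain n' m' where eq: "n = Suc n'" "m = Suc m'" and ge: "n' \<ge> N" "m' \<ge> N"
      using nm by (metis Suc_le_D Suc_le_mono)
    let ?s = "d ((T ^^ n') x) (T ((T ^^ n') x)) + d ((T ^^ m') x) (T ((T ^^ m') x))"
    have "d ((T ^^ n) x) ((T ^^ m) x) \<le> \<beta> * ?s"
      using kannan[OF orbit_closed orbit_closed, OF assms assms] eq by simp
    also have "\<dots> \<le> \<beta> * (2 * \<epsilon>)"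
      using N[OF ge(1)] N[OF ge(2)] beta_nonneg by (intro mult_left_mono) auto
    \<comment> \<open>Since \<open>2 * \<beta> < 1\<close>, the tolerance \<open>\<epsilon>\<close>
      for the steps needs no rescaling.\<close>
    also have "\<dots> < \<epsilon>"
      using \<open>\<epsilon> > 0\<close> beta_half by simp
    finally show ?thesis .
  qed
  then show "\<exists>N. \<forall>n\<ge>N. \<forall>m\<ge>N. d ((T ^^ n) x) ((T ^^ m) x) < \<epsilon>"
    by blast
qed

text \<open>A map satisfying the contraction inequality may be discontinuous, so one cannot pass to
  the limit inside \<open>T\<close>. The limit is taken inside \<open>\<Phi>\<close>
  instead.\<close>

lemma orbit_limit_fixed:
  assumes tri: "triangle_function X d \<Phi>"
    and cont: "continuous_on ({0..} \<times> {0..}) (\<lambda>(u, v). \<Phi> u v)"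
    and hom: "\<And>k u v. 0 \<le> k \<Longrightarrow> 0 \<le> u \<Longrightarrow> 0 \<le> v \<Longrightarrow> \<Phi> (k * u) (k * v) = k * \<Phi> u v"
    and lt: "\<Phi> 0 \<beta> < 1"
    and x: "x \<in> X" and l: "l \<in> X" and conv: "sm_converges d (\<lambda>n. (T ^^ n) x) l"
  shows "T l = l"
proof -
  define r where "r = d l (T l)"
  define e where "e n = d ((T ^^ n) x) (T ((T ^^ n) x))" for n
  \<comment> \<open>The index is shifted so that the intermediate point is the image of
    \<open>(T ^^ n) x\<close>, whose distance to \<open>T l\<close> the contraction inequality
    controls.\<close>
  define g where "g n = d l ((T ^^ Suc n) x)" for n
  have Tl: "T l \<in> X"
    using T_closed l by blast
  have orbit: "(T ^^ n) x \<in> X" for n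
    by (rule orbit_closed[OF x])
  have r_nonneg: "0 \<le> r"
    unfolding r_def by (rule nonneg[OF l Tl])
  have e_nonneg: "0 \<le> e n" for n
    unfolding e_def using nonneg[OF orbit orbit, of n "Suc n"] by simp
  have g_nonneg: "0 \<le> g n" for n
    unfolding g_def by (rule nonneg[OF l orbit])
  have e_lim: "e \<longlonglongrightarrow> 0"
    unfolding e_def using orbit_step_tendsto_0[OF x] .
  have g_lim: "g \<longlonglongrightarrow> 0"
    using LIMSEQ_Suc[OF conv[unfolded sm_converges_def]]
    unfolding g_def by (simp only: sym[OF orbit l])
  have bound: "r \<le> \<Phi> (g n) (\<beta> * (e n + r))" for n
  proof -
    have "r \<le> \<Phi> (g n) (d ((T ^^ Suc n) x) (T l))"
      using tri l Tl orbit[of "Suc n"] unfolding triangle_function_def r_def g_def by metis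
    also have "\<dots> \<le> \<Phi> (g n) (\<beta> * (e n + r))"
    proof (rule mono_onD[of "{0..}" "\<Phi> (g n)"])
      show "mono_on {0..} (\<Phi> (g n))"
        using tri g_nonneg[of n] unfolding triangle_function_def by simp
      show "d ((T ^^ Suc n) x) (T l) \<le> \<beta> * (e n + r)"
        using kannan[OF orbit l, of n] unfolding e_def r_def by simp
      show "d ((T ^^ Suc n) x) (T l) \<in> {0..}"
        using nonneg[OF orbit Tl] by (simp only: atLeast_iff)
    qed (use beta_nonneg e_nonneg r_nonneg in simp)
    finally show ?thesis .
  qed
  have "(\<lambda>n. (g n, \<beta> * (e n + r))) \<longlonglongrightarrow> (0, \<beta> * (0 + r))"
    by (intro tendsto_intros g_lim e_lim)
  \<comment> \<open>Continuity holds on the closed quadrant only; the nonnegativity facts keep the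
    sequence and its limit, a boundary point, inside it.\<close>
  then have "(\<lambda>n. \<Phi> (g n) (\<beta> * (e n + r))) \<longlonglongrightarrow> \<Phi> 0 (\<beta> * (0 + r))"
    using continuous_on_tendsto_compose[OF cont,
        of "\<lambda>n. (g n, \<beta> * (e n + r))" "(0, \<beta> * (0 + r))" sequentially]
      g_nonneg e_nonneg r_nonneg beta_nonneg by simp
  then have "r \<le> \<Phi> 0 (\<beta> * (0 + r))"
    by (rule LIMSEQ_le_const) (use bound in blast)
  \<comment> \<open>Homogeneity with factor \<open>r\<close>, writing the first argument 0 as
    \<open>r * 0\<close>.\<close>
  also have "\<dots> = r * \<Phi> 0 \<beta>"
    using hom[of r 0 \<beta>] r_nonneg beta_nonneg by (simp add: mult.commute)
  finally have "r * (1 - \<Phi> 0 \<beta>) \<le> 0"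
    by (simp add: algebra_simps)
  then have "r = 0"
    using r_nonneg lt by (simp add: mult_le_0_iff)
  then show ?thesis
    using zero_iff[OF l Tl] unfolding r_def by simp
qed

end

theorem theorem3p2:
  fixes X :: "'a set" and d :: "'a \<Rightarrow> 'a \<Rightarrow> real"
    and \<Phi> :: "real \<Rightarrow> real \<Rightarrow> real" and T :: "'a \<Rightarrow> 'a" and \<beta> :: real
  assumes "semimetric_space X d"
    and "sm_complete X d"
    and "triangle_function X d \<Phi>"
    and "continuous_on ({0..} \<times> {0..}) (\<lambda>(u, v). \<Phi> u v)"
    and "\<forall>k\<ge>0. \<forall>u\<ge>0. \<forall>v\<ge>0. \<Phi> (k * u) (k * v) = k * \<Phi> u v"
    and "\<forall>a. 0 \<le> a \<and> a < 1 \<longrightarrow> (\<exists>C>0. \<forall>p\<ge>1. nested \<Phi> a 0 p \<le> C)"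
    and "T \<in> X \<rightarrow> X"
    and "0 \<le> \<beta>" and "\<beta> < 1 / 2"
    and "\<forall>x\<in>X. \<forall>y\<in>X. d (T x) (T y) \<le> \<beta> * (d x (T x) + d y (T y))"
    and "\<Phi> 0 \<beta> < 1"
  shows "\<exists>!x. x \<in> X \<and> T x = x"
proof -
  interpret kannan_map X d T \<beta>
  proof (rule kannan_map.intro[OF assms(1)], unfold_locales)
    show "d (T x) (T y) \<le> \<beta> * (d x (T x) + d y (T y))" if "x \<in> X" "y \<in> X" for x y
      using assms(10) that by blast
  qed (fact assms)+
  \<comment> \<open>Any starting point will do: one convergent orbit gives existence.\<close>
  obtain x where x: "x \<in> X"
    using nonempty by blast
  obtain l where l: "l \<in> X" "sm_converges d (\<lambda>n. (T ^^ n) x) l"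
    using \<open>sm_complete X d\<close>[unfolded sm_complete_def, rule_format, of "\<lambda>n. (T ^^ n) x"]
      orbit_Cauchy[OF x] orbit_closed[OF x] by blast
  have "T l = l"
    using assms(5) by (intro orbit_limit_fixed[OF assms(3,4) _ assms(11) x l]) blast
  then show ?thesis
    using l(1) fixed_point_unique by blast
qed

end
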